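(* Let $k$ be a rig of characteristic zero and let $\mathbf{A}$ be a patch-finite (small) category. If $\mathbf{A}$ has fine Möbius inversion over $k$, then $\mathbf{A}$ also has coarse Möbius inversion over $k$, and the coarse Möbius function is given in terms of the fine one by $$\mu_{\mathbf{A}}(a,b)=\sum_{f\in \mathbf{A}(a,b)}\mu_{\mathbf{A}}(f)$$ for all objects $a,b$ of $\mathbf{A}$.
   Context: A rig is a set with a commutative monoid structure $(+,0)$ and a commutative monoid structure $(\cdot,1)$, the latter distributing over the former (including $0\cdot x=0$); that is, a commutative ring except that additive inverses need not exist. A natural number $n$ is also regarded as the element $n\cdot 1\in k$. The rig $k$ has characteristic zero if $0$ is the only natural number $n$ with $n\cdot 1=0$ in $k$. For a small category $\mathbf{A}$, $\mathbf{A}_0$ is its set of objects, $\mathbf{A}_1$ its set of maps, $\mathbf{A}(a,b)$ the set of maps $a\to b$. $\mathbf{A}$ is finely finite if for each map $f:a\to b$ there are only finitely many pairs of composable maps $a\xrightarrow{g}c\xrightarrow{h}b$ with $hg=f$. $\mathbf{A}$ is patch-finite if it is finely finite and all sets $\mathbf{A}(a,b)$ are finite (equivalently: for all $a,b$ the set of objects $c$ for which there exist maps $a\to c\to b$ is finite, and all $\mathbf{A}(a,b)$ are finite). Fine theory ($\mathbf{A}$ finely finite): the fine incidence algebra $k\mathbf{A}$ is the set of functions $\mathbf{A}_1\to k$ with pointwise $k$-module structure and product $(\alpha*\beta)(f)=\sum_{hg=f}\alpha(g)\beta(h)$; the unit $\delta$ is $1$ on identities and $0$ on other maps. The fine zeta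 function is $\zeta_{\mathbf{A}}(f)=1$ for all $f$. $\mathbf{A}$ has fine Möbius inversion over $k$ if $\zeta_{\mathbf{A}}$ is invertible in $k\mathbf{A}$; its inverse is the fine Möbius function, with values $\mu_{\mathbf{A}}(f)$. Coarse theory ($\mathbf{A}$ patch-finite): for $a,b\in\mathbf{A}_0$ let $[a,b]_{\mathbf{A}}$ be the full subcategory on the objects $c$ for which there exist maps $a\to c\to b$. The algebra $k_{\mathrm p}\mathbf{A}$ is the set of functions $\alpha:\mathbf{A}_0\times\mathbf{A}_0\to k$ such that $\alpha(a,b)=0$ whenever $\mathbf{A}(a,b)=\emptyset$, with pointwise module structure, product $(\alpha*\beta)(a,b)=\sum_{c\in[a,b]_{\mathbf{A}}}\alpha(a,c)\beta(c,b)$, and unit the Kronecker delta. The coarse zeta function $\zeta_{\mathbf{A}}\in k_{\mathrm p}\mathbf{A}$ is $\zeta_{\mathbf{A}}(a,b)=\#\mathbf{A}(a,b)\in k$. $\mathbf{A}$ has coarse Möbius inversion over $k$ if $\zeta_{\mathbf{A}}$ is invertible in $k_{\mathrm p}\mathbf{A}$; its inverse is the coarse Möbius function, with values $\mu_{\mathbf{A}}(a,b)$. *)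

theory Defs
  imports "HOL-Algebra.Module"
begin

record ('o, 'm) precategory =
  obj :: "'o set"
  mor :: "'m set"
  src :: "'m \<Rightarrow> 'o"
  tgt :: "'m \<Rightarrow> 'o"
  ident :: "'o \<Rightarrow> 'm"
  cmp :: "'m \<Rightarrow> 'm \<Rightarrow> 'm"

text \<open>Composition is written in the classical order: \<open>cmp A h g\<close> is ``\<open>h\<close> after \<open>g\<close>'', and is
  only constrained for composable pairs. Sets of objects and of maps are sets in the sense of HOL,
  so every category here is small.\<close>

locale category =
  fixes A :: "('o, 'm) precategory"
  assumes src_in: "f \<in> mor A \<Longrightarrow> src A f \<in> obj A"
    and tgt_in: "f \<in> mor A \<Longrightarrow> tgt A f \<in> obj A"
    and ident_in: "a \<in> obj A \<Longrightarrow> ident A a \<in> mor A"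
    and src_ident: "a \<in> obj A \<Longrightarrow> src A (ident A a) = a"
    and tgt_ident: "a \<in> obj A \<Longrightarrow> tgt A (ident A a) = a"
    and cmp_in: "g \<in> mor A \<Longrightarrow> h \<in> mor A \<Longrightarrow> tgt A g = src A h \<Longrightarrow> cmp A h g \<in> mor A"
    and src_cmp: "g \<in> mor A \<Longrightarrow> h \<in> mor A \<Longrightarrow> tgt A g = src A h \<Longrightarrow> src A (cmp A h g) = src A g"
    and tgt_cmp: "g \<in> mor A \<Longrightarrow> h \<in> mor A \<Longrightarrow> tgt A g = src A h \<Longrightarrow> tgt A (cmp A h g) = tgt A h"
    and cmp_ident_right: "f \<in> mor A \<Longrightarrow> cmp A f (ident A (src A f)) = f"
    and cmp_ident_left: "f \<in> mor A \<Longrightarrow> cmp A (ident A (tgt A f)) f = f"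
    and cmp_assoc: "f \<in> mor A \<Longrightarrow> g \<in> mor A \<Longrightarrow> h \<in> mor A \<Longrightarrow>
      tgt A f = src A g \<Longrightarrow> tgt A g = src A h \<Longrightarrow>
      cmp A h (cmp A g f) = cmp A (cmp A h g) f"

definition homset :: "('o, 'm) precategory \<Rightarrow> 'o \<Rightarrow> 'o \<Rightarrow> 'm set" where
  "homset A a b = {f \<in> mor A. src A f = a \<and> tgt A f = b}"

definition factorizations :: "('o, 'm) precategory \<Rightarrow> 'm \<Rightarrow> ('m \<times> 'm) set" where
  "factorizations A f =
    {(g, h). g \<in> mor A \<and> h \<in> mor A \<and> tgt A g = src A h \<and> cmp A h g = f}"

definition finely_finite :: "('o, 'm) precategory \<Rightarrow> bool" where
  "finely_finite A \<longleftrightarrow> (\<forall>f\<in>mor A. finite (factorizations A f))"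

definition patch_finite :: "('o, 'm) precategory \<Rightarrow> bool" where
  "patch_finite A \<longleftrightarrow> finely_finite A \<and> (\<forall>a\<in>obj A. \<forall>b\<in>obj A. finite (homset A a b))"

text \<open>The class \<open>comm_semiring_1\<close> consists of the rigs with \<open>0 \<noteq> 1\<close>, a condition implied by
  characteristic zero. The condition below is weaker than the class \<open>semiring_char_0\<close>, which asks
  that \<open>of_nat\<close> be injective; without additive inverses the two need not coincide.\<close>

definition rig_char_zero :: "'k::comm_semiring_1 itself \<Rightarrow> bool" where
  "rig_char_zero _ \<longleftrightarrow> (\<forall>n. (of_nat n :: 'k) = 0 \<longrightarrow> n = 0)"

text \<open>A function on \<open>mor A\<close> (or on pairs of objects) is represented by its extensional
  representative, so that equality in the algebras is equality of functions on that domain and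
  inverses are unique. The algebras are records of HOL-Algebra; their units and inverses are
  therefore the two-sided ones given by \<^const>\<open>Units\<close> and \<^const>\<open>m_inv\<close>.\<close>

definition fine_algebra ::
    "('o, 'm) precategory \<Rightarrow> ('k::comm_semiring_1, 'm \<Rightarrow> 'k) module" where
  "fine_algebra A =
    \<lparr>carrier = mor A \<rightarrow>\<^sub>E UNIV,
     mult = (\<lambda>\<alpha> \<beta>. \<lambda>f\<in>mor A. \<Sum>(g, h)\<in>factorizations A f. \<alpha> g * \<beta> h),
     one = (\<lambda>f\<in>mor A. if f \<in> ident A ` obj A then 1 else 0),
     zero = (\<lambda>f\<in>mor A. 0),
     add = (\<lambda>\<alpha> \<beta>. \<lambda>f\<in>mor A. \<alpha> f + \<beta> f),
     smult = (\<lambda>r \<alpha>. \<lambda>f\<in>mor A. r * \<alpha> f)\<rparr>"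

definition fine_zeta :: "('o, 'm) precategory \<Rightarrow> 'm \<Rightarrow> 'k::comm_semiring_1" where
  "fine_zeta A = (\<lambda>f\<in>mor A. 1)"

definition has_fine_inversion ::
    "'k::comm_semiring_1 itself \<Rightarrow> ('o, 'm) precategory \<Rightarrow> bool" where
  "has_fine_inversion _ A \<longleftrightarrow> (fine_zeta A :: 'm \<Rightarrow> 'k) \<in> Units (fine_algebra A)"

definition fine_mobius :: "('o, 'm) precategory \<Rightarrow> 'm \<Rightarrow> 'k::comm_semiring_1" where
  "fine_mobius A = inv\<^bsub>fine_algebra A\<^esub> (fine_zeta A)"

definition full_subcategory ::
    "('o, 'm) precategory \<Rightarrow> 'o set \<Rightarrow> ('o, 'm) precategory" where
  "full_subcategory A S =
    A\<lparr>obj := S, mor := {f \<in> mor A. src A f \<in> S \<and> tgt A f \<in> S}\<rparr>"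

definition interval :: "('o, 'm) precategory \<Rightarrow> 'o \<Rightarrow> 'o \<Rightarrow> ('o, 'm) precategory" where
  "interval A a b =
    full_subcategory A {c \<in> obj A. homset A a c \<noteq> {} \<and> homset A c b \<noteq> {}}"

definition coarse_algebra ::
    "('o, 'm) precategory \<Rightarrow> ('k::comm_semiring_1, 'o \<times> 'o \<Rightarrow> 'k) module" where
  "coarse_algebra A =
    \<lparr>carrier = {\<alpha> \<in> obj A \<times> obj A \<rightarrow>\<^sub>E UNIV.
       \<forall>a\<in>obj A. \<forall>b\<in>obj A. homset A a b = {} \<longrightarrow> \<alpha> (a, b) = 0},
     mult = (\<lambda>\<alpha> \<beta>. \<lambda>(a, b)\<in>obj A \<times> obj A. \<Sum>c\<in>obj (interval A a b). \<alpha> (a, c) * \<beta> (c, b)),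
     one = (\<lambda>(a, b)\<in>obj A \<times> obj A. if a = b then 1 else 0),
     zero = (\<lambda>p\<in>obj A \<times> obj A. 0),
     add = (\<lambda>\<alpha> \<beta>. \<lambda>p\<in>obj A \<times> obj A. \<alpha> p + \<beta> p),
     smult = (\<lambda>r \<alpha>. \<lambda>p\<in>obj A \<times> obj A. r * \<alpha> p)\<rparr>"

definition coarse_zeta :: "('o, 'm) precategory \<Rightarrow> 'o \<times> 'o \<Rightarrow> 'k::comm_semiring_1" where
  "coarse_zeta A = (\<lambda>(a, b)\<in>obj A \<times> obj A. of_nat (card (homset A a b)))"

definition has_coarse_inversion ::
    "'k::comm_semiring_1 itself \<Rightarrow> ('o, 'm) precategory \<Rightarrow> bool" where
  "has_coarse_inversion _ A \<longleftrightarrow>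
    (coarse_zeta A :: 'o \<times> 'o \<Rightarrow> 'k) \<in> Units (coarse_algebra A)"

definition coarse_mobius :: "('o, 'm) precategory \<Rightarrow> 'o \<times> 'o \<Rightarrow> 'k::comm_semiring_1" where
  "coarse_mobius A = inv\<^bsub>coarse_algebra A\<^esub> (coarse_zeta A)"

end

theory Submission imports Defs begin

text \<open>Summing a function on maps over each hom-set sends the fine incidence algebra to the coarse
  one. This is a homomorphism of monoids. For products, a composable pair \<open>a \<rightarrow> c \<rightarrow> b\<close> is
  determined either by its composite \<open>f: a \<rightarrow> b\<close> together with a factorization of \<open>f\<close>, or by
  its middle object \<open>c\<close> together with a map from each of two hom-sets; evaluating
  \<open>\<Sum> \<alpha> g * \<beta> h\<close> over all such pairs in these two ways gives the image of the product and the
  product of the images (lemma \<open>hom_sum_mult\<close>). For units, a hom-set \<open>A(a, b)\<close> contains an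
  identity only if \<open>a = b\<close>, and then exactly one.

  The fine zeta function is constantly \<open>1\<close>, so its image counts the maps and is the coarse zeta
  function. A monoid homomorphism carries units to units and inverses to inverses, so if the fine
  zeta function is invertible then so is the coarse one, and its inverse is the image of the fine
  Moebius function, which is the asserted formula.

  That inverses are unique, so that the two Moebius functions really are the two-sided
  inverses, rests on associativity of the two convolutions (lemmas \<open>monoid_fine_algebra\<close> and
  \<open>monoid_coarse_algebra\<close>).\<close>

section \<open>Composable pairs\<close>

lemma homset_iff: "f \<in> homset A a b \<longleftrightarrow> f \<in> mor A \<and> src A f = a \<and> tgt A f = b"
  by (simp add: homset_def)

lemma factorizations_iff:
  "(g, h) \<in> factorizations A f \<longleftrightarrow>
    g \<in> mor A \<and> h \<in> mor A \<and> tgt A g = src A h \<and> cmp A h g = f"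
  by (simp add: factorizations_def)

lemma obj_interval_iff:
  "c \<in> obj (interval A a b) \<longleftrightarrow>
    c \<in> obj A \<and> (\<exists>g. g \<in> homset A a c) \<and> (\<exists>h. h \<in> homset A c b)"
  by (auto simp: interval_def full_subcategory_def)

context category
begin

lemma cmp_in_homset:
  "g \<in> homset A a c \<Longrightarrow> h \<in> homset A c b \<Longrightarrow> cmp A h g \<in> homset A a b"
  by (simp add: homset_iff cmp_in src_cmp tgt_cmp)

lemma ident_in_homset: "a \<in> obj A \<Longrightarrow> ident A a \<in> homset A a a"
  by (simp add: homset_iff ident_in src_ident tgt_ident)

lemma identity_in_homset_iff:
  assumes "a \<in> obj A" "f \<in> homset A a b"
  shows "f \<in> ident A ` obj A \<longleftrightarrow> a = b \<and> f = ident A a"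
  using assms by (auto simp: homset_iff src_ident tgt_ident)

text \<open>Each object of \<open>[a, b]\<close> is the middle object of some factorization of some map \<open>a \<rightarrow> b\<close>,
  and there are finitely many such maps, each with finitely many factorizations.\<close>

lemma finite_interval:
  assumes "patch_finite A" "a \<in> obj A" "b \<in> obj A"
  shows "finite (obj (interval A a b))"
proof (rule finite_subset)
  show "obj (interval A a b) \<subseteq> (\<Union>f\<in>homset A a b. (tgt A \<circ> fst) ` factorizations A f)"
  proof
    fix c assume "c \<in> obj (interval A a b)"
    then obtain g h where gh: "g \<in> homset A a c" "h \<in> homset A c b"
      by (auto simp: obj_interval_iff)
    then have "(g, h) \<in> factorizations A (cmp A h g)" "(tgt A \<circ> fst) (g, h) = c"
      by (auto simp: homset_iff factorizations_iff)
    then show "c \<in> (\<Union>f\<in>homset A a b. (tgt A \<circ> fst) ` factorizations A f)"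
      using cmp_in_homset[OF gh] by (intro UN_I image_eqI[where x = "(g, h)"]) auto
  qed
  show "finite (\<Union>f\<in>homset A a b. (tgt A \<circ> fst) ` factorizations A f)"
    using assms by (auto simp: patch_finite_def finely_finite_def homset_iff)
qed

end

section \<open>The incidence algebras as monoids\<close>

lemma fine_mult_apply:
  "f \<in> mor A \<Longrightarrow> (\<alpha> \<otimes>\<^bsub>fine_algebra A\<^esub> \<beta>) f = (\<Sum>(g, h)\<in>factorizations A f. \<alpha> g * \<beta> h)"
  by (simp add: fine_algebra_def)

lemma coarse_mult_apply:
  "a \<in> obj A \<Longrightarrow> b \<in> obj A \<Longrightarrow>
    (\<alpha> \<otimes>\<^bsub>coarse_algebra A\<^esub> \<beta>) (a, b) = (\<Sum>c\<in>obj (interval A a b). \<alpha> (a, c) * \<beta> (c, b))"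
  by (simp add: coarse_algebra_def)

context category
begin

text \<open>Both bracketings sum over the composable triples with composite \<open>f\<close>: a triple is a
  factorization of \<open>f\<close> together with a factorization of its first factor, or of its second.\<close>

lemma fine_mult_assoc:
  fixes \<alpha> \<beta> \<gamma> :: "'m \<Rightarrow> 'k::comm_semiring_1"
  assumes "finely_finite A" "f \<in> mor A"
  shows "((\<alpha> \<otimes>\<^bsub>fine_algebra A\<^esub> \<beta>) \<otimes>\<^bsub>fine_algebra A\<^esub> \<gamma>) f =
    (\<alpha> \<otimes>\<^bsub>fine_algebra A\<^esub> (\<beta> \<otimes>\<^bsub>fine_algebra A\<^esub> \<gamma>)) f"
proof -
  let ?F = "factorizations A"
  have fin: "finite (?F g)" if "g \<in> mor A" for g
    using assms that by (simp add: finely_finite_def)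
  have "((\<alpha> \<otimes>\<^bsub>fine_algebra A\<^esub> \<beta>) \<otimes>\<^bsub>fine_algebra A\<^esub> \<gamma>) f =
      (\<Sum>x\<in>?F f. \<Sum>y\<in>?F (fst x). \<alpha> (fst y) * \<beta> (snd y) * \<gamma> (snd x))"
    using assms by (auto simp: fine_mult_apply factorizations_iff sum_distrib_right
        split_def intro!: sum.cong)
  also have "\<dots> = (\<Sum>(x, y)\<in>Sigma (?F f) (\<lambda>x. ?F (fst x)). \<alpha> (fst y) * \<beta> (snd y) * \<gamma> (snd x))"
    using assms by (intro sum.Sigma) (auto simp: fin factorizations_iff)
  also have "\<dots> = (\<Sum>(x, y)\<in>Sigma (?F f) (\<lambda>x. ?F (snd x)). \<alpha> (fst x) * (\<beta> (fst y) * \<gamma> (snd y)))"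
    by (rule sum.reindex_bij_witness[where
        i = "\<lambda>((g, q), (h, l)). ((cmp A h g, l), (g, h))" and
        j = "\<lambda>((p, l), (g, h)). ((g, cmp A l h), (h, l))"])
      (auto simp: factorizations_iff cmp_in src_cmp tgt_cmp cmp_assoc mult.assoc)
  also have "\<dots> = (\<Sum>x\<in>?F f. \<Sum>y\<in>?F (snd x). \<alpha> (fst x) * (\<beta> (fst y) * \<gamma> (snd y)))"
    using assms by (intro sum.Sigma[symmetric]) (auto simp: fin factorizations_iff)
  also have "\<dots> = (\<alpha> \<otimes>\<^bsub>fine_algebra A\<^esub> (\<beta> \<otimes>\<^bsub>fine_algebra A\<^esub> \<gamma>)) f"
    using assms by (auto simp: fine_mult_apply factorizations_iff sum_distrib_left
        split_def intro!: sum.cong)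
  finally show ?thesis .
qed

text \<open>The only factorization of \<open>f\<close> whose first factor is an identity is \<open>f = f \<circ> id\<close>.\<close>

lemma fine_one_mult:
  fixes \<alpha> :: "'m \<Rightarrow> 'k::comm_semiring_1"
  assumes "finely_finite A" "f \<in> mor A"
  shows "(\<one>\<^bsub>fine_algebra A\<^esub> \<otimes>\<^bsub>fine_algebra A\<^esub> \<alpha>) f = \<alpha> f"
proof -
  have "(\<one>\<^bsub>fine_algebra A\<^esub> \<otimes>\<^bsub>fine_algebra A\<^esub> \<alpha>) f =
      (\<Sum>x\<in>factorizations A f. if x = (ident A (src A f), f) then \<alpha> f else 0)"
    using assms(2)
    by (auto simp: fine_algebra_def factorizations_iff cmp_ident_right tgt_ident src_cmp
        ident_in src_ident src_in intro!: sum.cong)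
  also have "\<dots> = \<alpha> f"
    using assms by (simp add: finely_finite_def factorizations_iff ident_in src_in tgt_ident
        cmp_ident_right)
  finally show ?thesis .
qed

lemma fine_mult_one:
  fixes \<alpha> :: "'m \<Rightarrow> 'k::comm_semiring_1"
  assumes "finely_finite A" "f \<in> mor A"
  shows "(\<alpha> \<otimes>\<^bsub>fine_algebra A\<^esub> \<one>\<^bsub>fine_algebra A\<^esub>) f = \<alpha> f"
proof -
  have "(\<alpha> \<otimes>\<^bsub>fine_algebra A\<^esub> \<one>\<^bsub>fine_algebra A\<^esub>) f =
      (\<Sum>x\<in>factorizations A f. if x = (f, ident A (tgt A f)) then \<alpha> f else 0)"
    using assms(2)
    by (auto simp: fine_algebra_def factorizations_iff cmp_ident_left src_ident tgt_cmp
        ident_in tgt_ident tgt_in dest: sym intro!: sum.cong)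
  also have "\<dots> = \<alpha> f"
    using assms by (simp add: finely_finite_def factorizations_iff ident_in tgt_in src_ident
        cmp_ident_left)
  finally show ?thesis .
qed

lemma monoid_fine_algebra:
  assumes "finely_finite A"
  shows "monoid (fine_algebra A :: ('k::comm_semiring_1, 'm \<Rightarrow> 'k) module)"
proof
  have ext: "\<alpha> = \<beta>" if "\<alpha> \<in> carrier (fine_algebra A)" "\<beta> \<in> carrier (fine_algebra A)"
    "\<And>f. f \<in> mor A \<Longrightarrow> \<alpha> f = \<beta> f" for \<alpha> \<beta> :: "'m \<Rightarrow> 'k"
    using that by (auto simp: fine_algebra_def intro: PiE_ext)
  show closed: "\<alpha> \<otimes>\<^bsub>fine_algebra A\<^esub> \<beta> \<in> carrier (fine_algebra A)" for \<alpha> \<beta> :: "'m \<Rightarrow> 'k"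
    by (simp add: fine_algebra_def)
  show one: "\<one>\<^bsub>fine_algebra A\<^esub> \<in> carrier (fine_algebra A :: ('k, 'm \<Rightarrow> 'k) module)"
    by (simp add: fine_algebra_def)
  fix \<alpha> \<beta> \<gamma> :: "'m \<Rightarrow> 'k"
  show "(\<alpha> \<otimes>\<^bsub>fine_algebra A\<^esub> \<beta>) \<otimes>\<^bsub>fine_algebra A\<^esub> \<gamma> =
      \<alpha> \<otimes>\<^bsub>fine_algebra A\<^esub> (\<beta> \<otimes>\<^bsub>fine_algebra A\<^esub> \<gamma>)"
    by (rule ext[OF closed closed fine_mult_assoc[OF assms]])
  assume \<alpha>: "\<alpha> \<in> carrier (fine_algebra A)"
  show "\<one>\<^bsub>fine_algebra A\<^esub> \<otimes>\<^bsub>fine_algebra A\<^esub> \<alpha> = \<alpha>"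
    by (rule ext[OF closed \<alpha> fine_one_mult[OF assms]])
  show "\<alpha> \<otimes>\<^bsub>fine_algebra A\<^esub> \<one>\<^bsub>fine_algebra A\<^esub> = \<alpha>"
    by (rule ext[OF closed \<alpha> fine_mult_one[OF assms]])
qed

text \<open>Both bracketings sum over the pairs of objects \<open>d\<close>, \<open>c\<close> for which there exist maps
  \<open>a \<rightarrow> d \<rightarrow> c \<rightarrow> b\<close>.\<close>

lemma coarse_mult_assoc:
  fixes \<alpha> \<beta> \<gamma> :: "'o \<times> 'o \<Rightarrow> 'k::comm_semiring_1"
  assumes "patch_finite A" "a \<in> obj A" "b \<in> obj A"
  shows "((\<alpha> \<otimes>\<^bsub>coarse_algebra A\<^esub> \<beta>) \<otimes>\<^bsub>coarse_algebra A\<^esub> \<gamma>) (a, b) =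
    (\<alpha> \<otimes>\<^bsub>coarse_algebra A\<^esub> (\<beta> \<otimes>\<^bsub>coarse_algebra A\<^esub> \<gamma>)) (a, b)"
proof -
  let ?I = "\<lambda>a b. obj (interval A a b)"
  have fin: "finite (?I x y)" if "x \<in> obj A" "y \<in> obj A" for x y
    using finite_interval[OF assms(1)] that .
  have "((\<alpha> \<otimes>\<^bsub>coarse_algebra A\<^esub> \<beta>) \<otimes>\<^bsub>coarse_algebra A\<^esub> \<gamma>) (a, b) =
      (\<Sum>c\<in>?I a b. \<Sum>d\<in>?I a c. \<alpha> (a, d) * \<beta> (d, c) * \<gamma> (c, b))"
    using assms by (auto simp: coarse_mult_apply obj_interval_iff sum_distrib_right
        intro!: sum.cong)
  also have "\<dots> = (\<Sum>(c, d)\<in>Sigma (?I a b) (?I a). \<alpha> (a, d) * \<beta> (d, c) * \<gamma> (c, b))"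
    using assms by (intro sum.Sigma) (auto simp: fin obj_interval_iff)
  also have "\<dots> = (\<Sum>(d, c)\<in>Sigma (?I a b) (\<lambda>d. ?I d b). \<alpha> (a, d) * (\<beta> (d, c) * \<gamma> (c, b)))"
    by (rule sum.reindex_bij_witness[where i = prod.swap and j = prod.swap])
      (auto simp: obj_interval_iff mult.assoc, (blast intro: cmp_in_homset)+)
  also have "\<dots> = (\<Sum>d\<in>?I a b. \<Sum>c\<in>?I d b. \<alpha> (a, d) * (\<beta> (d, c) * \<gamma> (c, b)))"
    using assms by (intro sum.Sigma[symmetric]) (auto simp: fin obj_interval_iff)
  also have "\<dots> = (\<alpha> \<otimes>\<^bsub>coarse_algebra A\<^esub> (\<beta> \<otimes>\<^bsub>coarse_algebra A\<^esub> \<gamma>)) (a, b)"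
    using assms by (auto simp: coarse_mult_apply obj_interval_iff sum_distrib_left
        intro!: sum.cong)
  finally show ?thesis .
qed

text \<open>If there are no maps \<open>a \<rightarrow> b\<close> then \<open>[a, b]\<close> is empty, and the condition defining the
  carrier is what makes the unit laws hold; otherwise \<open>a\<close> and \<open>b\<close> are themselves in
  \<open>[a, b]\<close>.\<close>

lemma coarse_one_mult:
  fixes \<alpha> :: "'o \<times> 'o \<Rightarrow> 'k::comm_semiring_1"
  assumes "patch_finite A" "a \<in> obj A" "b \<in> obj A" "\<alpha> \<in> carrier (coarse_algebra A)"
  shows "(\<one>\<^bsub>coarse_algebra A\<^esub> \<otimes>\<^bsub>coarse_algebra A\<^esub> \<alpha>) (a, b) = \<alpha> (a, b)"
proof -
  have "(\<one>\<^bsub>coarse_algebra A\<^esub> \<otimes>\<^bsub>coarse_algebra A\<^esub> \<alpha>) (a, b) =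
      (\<Sum>c\<in>obj (interval A a b). if c = a then \<alpha> (a, b) else 0)"
    using assms(2,3) by (auto simp: coarse_algebra_def obj_interval_iff intro!: sum.cong)
  also have "\<dots> = (if homset A a b = {} then 0 else \<alpha> (a, b))"
    using assms finite_interval[OF assms(1-3)] ident_in_homset[of a]
    by (auto simp: obj_interval_iff)
  also have "\<dots> = \<alpha> (a, b)"
    using assms by (auto simp: coarse_algebra_def)
  finally show ?thesis .
qed

lemma coarse_mult_one:
  fixes \<alpha> :: "'o \<times> 'o \<Rightarrow> 'k::comm_semiring_1"
  assumes "patch_finite A" "a \<in> obj A" "b \<in> obj A" "\<alpha> \<in> carrier (coarse_algebra A)"
  shows "(\<alpha> \<otimes>\<^bsub>coarse_algebra A\<^esub> \<one>\<^bsub>coarse_algebra A\<^esub>) (a, b) = \<alpha> (a, b)"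
proof -
  have "(\<alpha> \<otimes>\<^bsub>coarse_algebra A\<^esub> \<one>\<^bsub>coarse_algebra A\<^esub>) (a, b) =
      (\<Sum>c\<in>obj (interval A a b). if c = b then \<alpha> (a, b) else 0)"
    using assms(2,3) by (auto simp: coarse_algebra_def obj_interval_iff intro!: sum.cong)
  also have "\<dots> = (if homset A a b = {} then 0 else \<alpha> (a, b))"
    using assms finite_interval[OF assms(1-3)] ident_in_homset[of b]
    by (auto simp: obj_interval_iff)
  also have "\<dots> = \<alpha> (a, b)"
    using assms by (auto simp: coarse_algebra_def)
  finally show ?thesis .
qed

lemma monoid_coarse_algebra:
  assumes "patch_finite A"
  shows "monoid (coarse_algebra A :: ('k::comm_semiring_1, 'o \<times> 'o \<Rightarrow> 'k) module)"
proof
  have ext: "\<alpha> = \<beta>" if "\<alpha> \<in> carrier (coarse_algebra A)" "\<beta> \<in> carrier (coarse_algebra A)"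
    "\<And>a b. a \<in> obj A \<Longrightarrow> b \<in> obj A \<Longrightarrow> \<alpha> (a, b) = \<beta> (a, b)" for \<alpha> \<beta> :: "'o \<times> 'o \<Rightarrow> 'k"
    using that by (auto simp: coarse_algebra_def intro: PiE_ext)
  show closed: "\<alpha> \<otimes>\<^bsub>coarse_algebra A\<^esub> \<beta> \<in> carrier (coarse_algebra A)"
    for \<alpha> \<beta> :: "'o \<times> 'o \<Rightarrow> 'k"
  proof -
    have "obj (interval A a b) = {}" if "homset A a b = {}" for a b
      using that cmp_in_homset by (fastforce simp: obj_interval_iff)
    then show ?thesis
      by (auto simp: coarse_algebra_def)
  qed
  show one: "\<one>\<^bsub>coarse_algebra A\<^esub> \<in> carrier (coarse_algebra A :: ('k, 'o \<times> 'o \<Rightarrow> 'k) module)"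
    using ident_in_homset by (auto simp: coarse_algebra_def)
  fix \<alpha> \<beta> \<gamma> :: "'o \<times> 'o \<Rightarrow> 'k"
  show "(\<alpha> \<otimes>\<^bsub>coarse_algebra A\<^esub> \<beta>) \<otimes>\<^bsub>coarse_algebra A\<^esub> \<gamma> =
      \<alpha> \<otimes>\<^bsub>coarse_algebra A\<^esub> (\<beta> \<otimes>\<^bsub>coarse_algebra A\<^esub> \<gamma>)"
    by (rule ext[OF closed closed coarse_mult_assoc[OF assms]])
  assume \<alpha>: "\<alpha> \<in> carrier (coarse_algebra A)"
  show "\<one>\<^bsub>coarse_algebra A\<^esub> \<otimes>\<^bsub>coarse_algebra A\<^esub> \<alpha> = \<alpha>"
    by (rule ext[OF closed \<alpha> coarse_one_mult[OF assms _ _ \<alpha>]])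
  show "\<alpha> \<otimes>\<^bsub>coarse_algebra A\<^esub> \<one>\<^bsub>coarse_algebra A\<^esub> = \<alpha>"
    by (rule ext[OF closed \<alpha> coarse_mult_one[OF assms _ _ \<alpha>]])
qed

end

section \<open>Summation over hom-sets\<close>

definition hom_sum ::
    "('o, 'm) precategory \<Rightarrow> ('m \<Rightarrow> 'k::comm_semiring_1) \<Rightarrow> 'o \<times> 'o \<Rightarrow> 'k" where
  "hom_sum A \<alpha> = (\<lambda>(a, b)\<in>obj A \<times> obj A. \<Sum>f\<in>homset A a b. \<alpha> f)"

lemma hom_sum_apply:
  "a \<in> obj A \<Longrightarrow> b \<in> obj A \<Longrightarrow> hom_sum A \<alpha> (a, b) = (\<Sum>f\<in>homset A a b. \<alpha> f)"
  by (simp add: hom_sum_def)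

lemma hom_sum_closed: "hom_sum A \<alpha> \<in> carrier (coarse_algebra A)"
  by (auto simp: hom_sum_def coarse_algebra_def)

lemma hom_sum_fine_zeta: "hom_sum A (fine_zeta A) = coarse_zeta A"
proof -
  have "(\<Sum>f\<in>homset A a b. fine_zeta A f) = of_nat (card (homset A a b))" for a b
  proof -
    have "(\<Sum>f\<in>homset A a b. fine_zeta A f) = (\<Sum>f\<in>homset A a b. 1)"
      by (rule sum.cong) (auto simp: fine_zeta_def homset_iff)
    then show ?thesis by simp
  qed
  then show ?thesis
    by (auto simp: hom_sum_def coarse_zeta_def fun_eq_iff)
qed

context category
begin

lemma hom_sum_one:
  assumes "patch_finite A"
  shows "hom_sum A \<one>\<^bsub>fine_algebra A\<^esub> =
    (\<one>\<^bsub>coarse_algebra A\<^esub> :: 'o \<times> 'o \<Rightarrow> 'k::comm_semiring_1)"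
proof -
  have "(\<Sum>f\<in>homset A a b. \<one>\<^bsub>fine_algebra A\<^esub> f) = (if a = b then 1 else 0 :: 'k)"
    if ab: "a \<in> obj A" "b \<in> obj A" for a b
  proof -
    have "(\<Sum>f\<in>homset A a b. \<one>\<^bsub>fine_algebra A\<^esub> f) =
        (\<Sum>f\<in>homset A a b. if f = ident A a then if a = b then 1 else 0 else 0 :: 'k)"
      using identity_in_homset_iff[OF ab(1), of _ b]
      by (intro sum.cong) (auto simp: fine_algebra_def homset_iff)
    also have "\<dots> = (if a = b then 1 else 0)"
      using assms ab ident_in_homset by (auto simp: patch_finite_def)
    finally show ?thesis .
  qed
  then show ?thesis
    by (auto simp: hom_sum_def coarse_algebra_def fun_eq_iff)
qed

text \<open>The composable pairs \<open>a \<rightarrow> c \<rightarrow> b\<close> are grouped on the left by their composite, on the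
  right by their middle object.\<close>

lemma hom_sum_mult:
  fixes \<alpha> \<beta> :: "'m \<Rightarrow> 'k::comm_semiring_1"
  assumes "patch_finite A"
  shows "hom_sum A (\<alpha> \<otimes>\<^bsub>fine_algebra A\<^esub> \<beta>) =
    hom_sum A \<alpha> \<otimes>\<^bsub>coarse_algebra A\<^esub> hom_sum A \<beta>"
proof -
  have "(\<Sum>f\<in>homset A a b. (\<alpha> \<otimes>\<^bsub>fine_algebra A\<^esub> \<beta>) f) =
      (\<Sum>c\<in>obj (interval A a b). hom_sum A \<alpha> (a, c) * hom_sum A \<beta> (c, b))"
    if ab: "a \<in> obj A" "b \<in> obj A" for a b
  proof -
    let ?H = "homset A" and ?I = "obj (interval A a b)"
    have finH: "finite (?H x y)" if "x \<in> obj A" "y \<in> obj A" for x y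
      using assms that by (simp add: patch_finite_def)
    have finF: "finite (factorizations A f)" if "f \<in> mor A" for f
      using assms that by (simp add: patch_finite_def finely_finite_def)
    have "(\<Sum>f\<in>?H a b. (\<alpha> \<otimes>\<^bsub>fine_algebra A\<^esub> \<beta>) f) =
        (\<Sum>f\<in>?H a b. \<Sum>x\<in>factorizations A f. \<alpha> (fst x) * \<beta> (snd x))"
      by (rule sum.cong) (auto simp: fine_mult_apply homset_iff split_def)
    also have "\<dots> =
        (\<Sum>(f, x)\<in>Sigma (?H a b) (factorizations A). \<alpha> (fst x) * \<beta> (snd x))"
      using ab by (intro sum.Sigma) (auto simp: finH finF homset_iff)
    also have "\<dots> = (\<Sum>(c, x)\<in>Sigma ?I (\<lambda>c. ?H a c \<times> ?H c b). \<alpha> (fst x) * \<beta> (snd x))"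
      by (rule sum.reindex_bij_witness[where
          i = "\<lambda>(c, (g, h)). (cmp A h g, (g, h))" and
          j = "\<lambda>(f, (g, h)). (tgt A g, (g, h))"])
        (auto simp: factorizations_iff obj_interval_iff homset_iff cmp_in src_cmp tgt_cmp src_in
          tgt_in)
    also have "\<dots> = (\<Sum>c\<in>?I. \<Sum>x\<in>?H a c \<times> ?H c b. \<alpha> (fst x) * \<beta> (snd x))"
      using ab finite_interval[OF assms ab]
      by (intro sum.Sigma[symmetric]) (auto simp: finH obj_interval_iff)
    also have "\<dots> = (\<Sum>c\<in>?I. hom_sum A \<alpha> (a, c) * hom_sum A \<beta> (c, b))"
      using ab by (intro sum.cong)
        (auto simp: hom_sum_apply obj_interval_iff sum_product sum.cartesian_product split_def)
    finally show ?thesis .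
  qed
  then show ?thesis
    by (auto simp: hom_sum_def coarse_algebra_def fun_eq_iff)
qed

end

section \<open>Coarse inversion from fine inversion\<close>

theorem theorem3p9:
  fixes A :: "('o, 'm) precategory"
  assumes "rig_char_zero TYPE('k::comm_semiring_1)"
    and "category A"
    and "patch_finite A"
    and "has_fine_inversion TYPE('k) A"
  shows "has_coarse_inversion TYPE('k) A \<and>
    (\<forall>a\<in>obj A. \<forall>b\<in>obj A.
      (coarse_mobius A (a, b) :: 'k) = (\<Sum>f\<in>homset A a b. fine_mobius A f))"
proof -
  interpret category A by fact
  let ?F = "fine_algebra A :: ('k, 'm \<Rightarrow> 'k) module"
  let ?C = "coarse_algebra A :: ('k, 'o \<times> 'o \<Rightarrow> 'k) module"
  interpret F: monoid ?F
    using monoid_fine_algebra assms(3) by (simp add: patch_finite_def)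
  interpret C: monoid ?C
    using monoid_coarse_algebra assms(3) .
  let ?z = "fine_zeta A :: 'm \<Rightarrow> 'k"
  let ?m = "fine_mobius A :: 'm \<Rightarrow> 'k"
  let ?\<zeta> = "coarse_zeta A :: 'o \<times> 'o \<Rightarrow> 'k"
  let ?\<mu> = "hom_sum A ?m :: 'o \<times> 'o \<Rightarrow> 'k"
  have unit: "?z \<in> Units ?F"
    using assms(4) by (simp add: has_fine_inversion_def)
  have left: "?\<mu> \<otimes>\<^bsub>?C\<^esub> ?\<zeta> = \<one>\<^bsub>?C\<^esub>"
    using F.Units_l_inv[OF unit] hom_sum_mult[OF assms(3), of ?m ?z]
    by (simp add: fine_mobius_def hom_sum_fine_zeta hom_sum_one[OF assms(3)])
  have right: "?\<zeta> \<otimes>\<^bsub>?C\<^esub> ?\<mu> = \<one>\<^bsub>?C\<^esub>"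
    using F.Units_r_inv[OF unit] hom_sum_mult[OF assms(3), of ?z ?m]
    by (simp add: fine_mobius_def hom_sum_fine_zeta hom_sum_one[OF assms(3)])
  have \<zeta>: "?\<zeta> \<in> carrier ?C"
    using hom_sum_closed[of A ?z] by (simp add: hom_sum_fine_zeta)
  have \<mu>: "?\<mu> \<in> carrier ?C"
    by (rule hom_sum_closed)
  have "?\<zeta> \<in> Units ?C"
    using \<zeta> \<mu> left right by (auto simp: Units_def)
  moreover have "coarse_mobius A = ?\<mu>"
    unfolding coarse_mobius_def using C.inv_unique'[OF \<zeta> \<mu> right left] by simp
  ultimately show ?thesis
    by (simp add: has_coarse_inversion_def hom_sum_apply)
qed

end
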